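(* For $d$ odd and $n\ge d+1$, the dual graph of the simplicial complex $\mathbf S_{n,d}$ is bipartite and the number of $d$-simplices of $\mathbf S_{n,d}$ equals the coefficient of $X^nY^{(d+1)/2}$ in the series expansion of the rational function $$\frac{1+X+X^3Y}{1-X^2-X^2Y-X^4Y}.$$
   Context: Let $a_1<\cdots<a_n$ be real numbers and let the cyclic polytope $C(n,d)$ be the convex hull in $\mathbb R^d$ of the points $(a_i,a_i^2,\ldots,a_i^d)$, $1\le i\le n$; points are labelled by $1,\dots,n$. For $d$ odd, the polytope $C(n,d)$ has a regular triangulation $\hat{\mathbf 0}_{n,d}$ (obtained by projecting the lower part of $C(n,d+1)$ with respect to the last coordinate) whose $d$-simplices are those with vertex sets $\{i_1,i_1+1,i_2,i_2+1,\ldots,i_{m},i_{m}+1\}$, where $m=\frac{d+1}2$, $1\le i_1$, $i_{m}+1\le n$ and $i_{j+1}\ge i_j+2$ for $1\le j<m$. Such a simplex is represented by the sequence $i_1<\cdots<i_{m}$. The complex $\mathbf S_{n,d}$ is the subcomplex of $\hat{\mathbf 0}_{n,d}$ whose maximal simplices are the $d$-simplices $i_1<\cdots<i_{m}$ such that for all $1\le j<m$, either $i_j$ is odd or $i_{j+1}-i_j>2$. The dual graph of a pure $d$-dimensional complex has its $d$-simplices as vertices, two being adjacent when they share a common facet. *)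

theory Defs
  imports "HOL-Analysis.Analysis" "HOL-Computational_Algebra.Formal_Power_Series"
begin

unbundle fps_syntax

section \<open>Cyclic polytopes and their lower triangulation\<close>

text \<open>
  The space of dimension \<open>d\<close> is \<open>real ^ 'd\<close> with \<open>d = CARD('d)\<close>. A bijection \<open>e\<close> from the
  index type \<open>'d\<close> onto \<open>{1..d}\<close> numbers the coordinates, so that \<open>moment_point e t\<close> is the point
  \<open>(t, t^2, \<dots>, t^d)\<close>. Of a sequence \<open>a :: nat \<Rightarrow> real\<close> only the values \<open>a 1, \<dots>, a n\<close> matter; the
  label of the point \<open>moment_point e (a i)\<close> is \<open>i\<close>.
\<close>

definition moment_point :: "('d::finite \<Rightarrow> nat) \<Rightarrow> real \<Rightarrow> real ^ 'd" where
  "moment_point e t = (\<chi> k. t ^ e k)"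

definition hull_of_labels :: "('d::finite \<Rightarrow> nat) \<Rightarrow> (nat \<Rightarrow> real) \<Rightarrow> nat set \<Rightarrow> (real ^ 'd) set" where
  "hull_of_labels e a I = convex hull ((\<lambda>i. moment_point e (a i)) ` I)"

text \<open>
  The polytope \<open>C(n,d+1)\<close>, in the space \<open>real ^ 'd \<times> real\<close> whose last coordinate is the second
  component of the pair.
\<close>

definition lifted_cyclic_polytope ::
    "('d::finite \<Rightarrow> nat) \<Rightarrow> (nat \<Rightarrow> real) \<Rightarrow> nat \<Rightarrow> ((real ^ 'd) \<times> real) set" where
  "lifted_cyclic_polytope e a n =
     convex hull ((\<lambda>i. (moment_point e (a i), a i ^ (CARD('d) + 1))) ` {1..n})"

text \<open>
  A face is lower if each of its points is the lowest point of the polytope on the vertical line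
  through it. This also covers \<open>n = d + 1\<close>, where the lifted polytope is a \<open>d\<close>-simplex and is a
  lower face of itself.
\<close>

definition lower_face_of :: "('a::real_vector \<times> real) set \<Rightarrow> ('a \<times> real) set \<Rightarrow> bool" where
  "lower_face_of F C \<longleftrightarrow> F face_of C \<and> (\<forall>x s t. (x, s) \<in> F \<and> (x, t) \<in> C \<longrightarrow> s \<le> t)"

text \<open>
  As for \<open>simplicial_complex\<close> in the library, a complex is a set of simplices closed under
  taking faces, so it contains the empty simplex.
\<close>

definition lower_triangulation ::
    "('d::finite \<Rightarrow> nat) \<Rightarrow> (nat \<Rightarrow> real) \<Rightarrow> nat \<Rightarrow> (real ^ 'd) set set" where
  "lower_triangulation e a n = {fst ` F | F. lower_face_of F (lifted_cyclic_polytope e a n)}"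

definition simplices_of_dim :: "nat \<Rightarrow> 'a::euclidean_space set set \<Rightarrow> 'a set set" where
  "simplices_of_dim d K = {\<sigma> \<in> K. int d simplex \<sigma>}"

section \<open>The complex S\<close>

text \<open>The sequences \<open>i 1 < \<dots> < i m\<close> representing \<open>d\<close>-simplices of the lower triangulation,
  \<open>m = (d+1)/2\<close>.\<close>

definition simplex_seq :: "nat \<Rightarrow> nat \<Rightarrow> (nat \<Rightarrow> nat) \<Rightarrow> bool" where
  "simplex_seq n m i \<longleftrightarrow>
     1 \<le> i 1 \<and> i m + 1 \<le> n \<and> (\<forall>j. 1 \<le> j \<and> j < m \<longrightarrow> i (j + 1) \<ge> i j + 2)"

definition seq_labels :: "nat \<Rightarrow> (nat \<Rightarrow> nat) \<Rightarrow> nat set" where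
  "seq_labels m i = (\<Union>j\<in>{1..m}. {i j, i j + 1})"

definition S_maximal_simplices ::
    "('d::finite \<Rightarrow> nat) \<Rightarrow> (nat \<Rightarrow> real) \<Rightarrow> nat \<Rightarrow> (real ^ 'd) set set" where
  "S_maximal_simplices e a n =
     {\<sigma> \<in> simplices_of_dim CARD('d) (lower_triangulation e a n).
        \<exists>i. simplex_seq n ((CARD('d) + 1) div 2) i \<and>
            \<sigma> = hull_of_labels e a (seq_labels ((CARD('d) + 1) div 2) i) \<and>
            (\<forall>j. 1 \<le> j \<and> j < (CARD('d) + 1) div 2 \<longrightarrow> odd (i j) \<or> int (i (j + 1)) - int (i j) > 2)}"

definition S_complex ::
    "('d::finite \<Rightarrow> nat) \<Rightarrow> (nat \<Rightarrow> real) \<Rightarrow> nat \<Rightarrow> (real ^ 'd) set set" where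
  "S_complex e a n =
     {\<tau> \<in> lower_triangulation e a n. \<exists>\<sigma> \<in> S_maximal_simplices e a n. \<tau> face_of \<sigma>}"

section \<open>Dual graphs\<close>

definition dual_graph_edges :: "nat \<Rightarrow> 'a::euclidean_space set set \<Rightarrow> 'a set set set" where
  "dual_graph_edges d K =
     {{\<sigma>, \<tau>} | \<sigma> \<tau>. \<sigma> \<in> simplices_of_dim d K \<and> \<tau> \<in> simplices_of_dim d K \<and> \<sigma> \<noteq> \<tau> \<and>
        (\<exists>F. F facet_of \<sigma> \<and> F facet_of \<tau>)}"

definition bipartite :: "'v set \<Rightarrow> 'v set set \<Rightarrow> bool" where
  "bipartite V E \<longleftrightarrow>
     (\<exists>A B. A \<union> B = V \<and> A \<inter> B = {} \<and> (\<forall>e\<in>E. \<exists>x\<in>A. \<exists>y\<in>B. e = {x, y}))"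

section \<open>The generating function\<close>

text \<open>
  Power series in \<open>X\<close> and \<open>Y\<close> are power series in \<open>X\<close> whose coefficients are power series
  in \<open>Y\<close>: the coefficient of \<open>X^n Y^m\<close> in \<open>F\<close> is \<open>F $ n $ m\<close>.
\<close>

abbreviation (input) ser_X :: "rat fps fps" where "ser_X \<equiv> fps_X"
abbreviation (input) ser_Y :: "rat fps fps" where "ser_Y \<equiv> fps_const fps_X"

definition S_series :: "rat fps fps" where
  "S_series =
     (1 + ser_X + ser_X ^ 3 * ser_Y) / (1 - ser_X ^ 2 - ser_X ^ 2 * ser_Y - ser_X ^ 4 * ser_Y)"

text \<open>The denominator is a unit of \<open>rat fps fps\<close>, so the division is exact although
  \<open>rat fps\<close> is not a field.\<close>

lemma S_series_times_denominator:
  "S_series * (1 - ser_X ^ 2 - ser_X ^ 2 * ser_Y - ser_X ^ 4 * ser_Y)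
     = 1 + ser_X + ser_X ^ 3 * ser_Y"
proof -
  define D :: "rat fps fps" where
    "D = 1 - ser_X ^ 2 - ser_X ^ 2 * ser_Y - ser_X ^ 4 * ser_Y"
  have D0: "D $ 0 = 1"
    by (simp add: D_def)
  then have "D * inverse D = 1"
    unfolding fps_inverse_def by (intro fps_right_inverse) simp
  moreover have "unit_factor D = D" "subdegree D = 0"
    using D0 by (auto simp: fps_unit_factor_def)
  ultimately show ?thesis
    unfolding S_series_def D_def[symmetric] fps_divide_def
    by (simp add: mult.assoc mult.commute[of "inverse D" D])
qed

end

theory Submission
  imports Defs
begin

text \<open>
  Everything about the \<open>d\<close>-simplices of the complex can be read off their label sets. The
  condition on the sequences says that the labels form a union of dominoes \<open>{s, s + 1}\<close>, laid
  from left to right without overlap, in which a domino with even \<open>s\<close> does not touch the domino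
  before it. (A domino with even \<open>s\<close> does not touch its successor either: the successor would
  start at the even number \<open>s + 2\<close> and touch its predecessor.)

  Geometry. A polynomial of degree at most \<open>d + 1\<close> is an affine functional on the lifted moment
  curve. The polynomial with simple roots at the points labelled by a union of dominoes is
  nonnegative at all the points, since no label lies strictly between \<open>s\<close> and \<open>s + 1\<close>; being
  monic of degree \<open>d + 1\<close>, it exhibits the simplex as a lower face
  (\<open>hull_of_domino_set_in_lower_triangulation\<close>). Polynomials of degree at most \<open>d\<close> show that
  any \<open>d + 1\<close> points of the moment curve are affinely independent. So simplices
  correspond to label sets, and adjacent simplices to label sets that agree after the deletion of
  one label from each.

  Colouring. Group the positive integers in pairs \<open>{2k - 1, 2k}\<close>. A domino with odd \<open>s\<close> is a
  pair, and one with even \<open>s\<close> consists of two labels whose partners are both missing. Colour a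
  label set by the parity of the number of its even dominoes. Deleting a label changes the number
  of labels without a partner by one, up or down. If it goes up for one of two adjacent sets and
  down for the other, their numbers of even dominoes differ by one. If it goes the same way for
  both, the deleted label can be recovered from what remains, because labels without a partner
  come in even dominoes; so the sets agree (\<open>colour_change\<close>).

  Counting. Removing the domino that contains the largest admissible label gives a recurrence in
  \<open>n\<close> that depends on the parity of \<open>n\<close>. Applied several times, it gives the
  recurrence of order four, independent of the parity, that the denominator of the rational
  function encodes (\<open>S_series_nth\<close>).
\<close>

section \<open>Label sets as unions of dominoes\<close>

inductive domino_set :: "nat set \<Rightarrow> bool" where
  empty: "domino_set {}"
| add_domino: "domino_set J \<Longrightarrow> 1 \<le> s \<Longrightarrow> J \<subseteq> {1..<s} \<Longrightarrow> (even s \<Longrightarrow> s - 1 \<notin> J)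
    \<Longrightarrow> domino_set (insert s (insert (s + 1) J))"

lemma domino_set_finite: "domino_set I \<Longrightarrow> finite I"
  by (induction rule: domino_set.induct) auto

lemma domino_set_ge_1: "domino_set I \<Longrightarrow> I \<subseteq> {1..}"
  by (induction rule: domino_set.induct) auto

lemma seq_labels_Suc:
  "seq_labels (Suc m) i = insert (i (Suc m)) (insert (i (Suc m) + 1) (seq_labels m i))"
  by (auto simp: seq_labels_def atLeastAtMostSuc_conv)

lemma domino_set_seq_labels:
  assumes "1 \<le> m" "1 \<le> i 1"
    and "\<And>j. 1 \<le> j \<Longrightarrow> j < m \<Longrightarrow> i j + 2 \<le> i (j + 1)"
    and "\<And>j. 1 \<le> j \<Longrightarrow> j < m \<Longrightarrow> odd (i j) \<or> i j + 2 < i (j + 1)"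
  shows "domino_set (seq_labels m i) \<and> seq_labels m i \<subseteq> {1..i m + 1}
    \<and> card (seq_labels m i) = 2 * m"
  using assms
proof (induction m rule: nat_induct_at_least)
  case base
  have "seq_labels 1 i = insert (i 1) (insert (i 1 + 1) {})"
    by (auto simp: seq_labels_def)
  moreover have "domino_set (insert (i 1) (insert (i 1 + 1) {}))"
    using base by (intro domino_set.intros) auto
  ultimately show ?case
    using base by auto
next
  case (Suc m)
  have IH: "domino_set (seq_labels m i)" "seq_labels m i \<subseteq> {1..i m + 1}"
    "card (seq_labels m i) = 2 * m"
    using Suc by auto
  have gap: "i m + 2 \<le> i (Suc m)" "odd (i m) \<or> i m + 2 < i (Suc m)"
    using Suc.prems(2,3)[of m] Suc.hyps by auto
  have below: "seq_labels m i \<subseteq> {1..<i (Suc m)}"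
    using IH(2) gap(1) by (auto dest!: subsetD)
  have "i (Suc m) - 1 \<notin> seq_labels m i" if "even (i (Suc m))"
  proof
    assume "i (Suc m) - 1 \<in> seq_labels m i"
    then have "i (Suc m) = i m + 2"
      using IH(2) gap(1) by (auto dest!: subsetD)
    then show False using gap(2) that by auto
  qed
  then have "domino_set (seq_labels (Suc m) i)"
    unfolding seq_labels_Suc using IH below gap(1) by (intro domino_set.intros) auto
  moreover have "i (Suc m) \<notin> seq_labels m i" "i (Suc m) + 1 \<notin> seq_labels m i"
    using below by auto
  moreover have "seq_labels (Suc m) i \<subseteq> {1..i (Suc m) + 1}"
    using below gap(1) unfolding seq_labels_Suc by (auto dest!: subsetD)
  ultimately show ?case
    using IH domino_set_finite[OF IH(1)] by (simp add: seq_labels_Suc)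
qed

text \<open>
  The sequence lists the first labels of the dominoes. A gap of exactly \<open>2\<close> means that two
  dominoes touch; their first labels then have the same parity, which must be odd.
\<close>

lemma domino_set_imp_seq_labels:
  assumes "domino_set I"
  shows "\<exists>m i. I = seq_labels m i \<and> card I = 2 * m \<and>
    (\<forall>j. 1 \<le> j \<and> j < m \<longrightarrow> i j + 2 \<le> i (j + 1) \<and> (odd (i j) \<or> i j + 2 < i (j + 1)))"
  using assms
proof (induction rule: domino_set.induct)
  case empty
  show ?case by (rule exI[of _ 0]) (auto simp: seq_labels_def)
next
  case (add_domino J s)
  then obtain m i where mi: "J = seq_labels m i" "card J = 2 * m"
    "\<And>j. 1 \<le> j \<Longrightarrow> j < m \<Longrightarrow> i j + 2 \<le> i (j + 1)"
    "\<And>j. 1 \<le> j \<Longrightarrow> j < m \<Longrightarrow> odd (i j) \<or> i j + 2 < i (j + 1)"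
    by blast
  define i' where "i' = i(Suc m := s)"
  have "seq_labels m i' = seq_labels m i"
    by (auto simp: seq_labels_def i'_def)
  then have labels: "insert s (insert (s + 1) J) = seq_labels (Suc m) i'"
    by (simp add: seq_labels_Suc mi(1) i'_def)
  have "s \<notin> J" "s + 1 \<notin> J"
    using add_domino.hyps by auto
  then have card: "card (insert s (insert (s + 1) J)) = 2 * Suc m"
    using mi(2) domino_set_finite[OF add_domino.hyps(1)] by simp
  have "i' j + 2 \<le> i' (j + 1) \<and> (odd (i' j) \<or> i' j + 2 < i' (j + 1))" if j: "1 \<le> j" "j < Suc m" for j
  proof (cases "j = m")
    case True
    \<comment> \<open>The last label of \<open>J\<close> is compared with \<open>s\<close>: it is smaller, and not \<open>s - 1\<close> if \<open>s\<close> is even.\<close>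
    \<comment> \<open>This last label of \<open>J\<close> is below \<open>s\<close>, and it is not \<open>s - 1\<close> if \<open>s\<close> is even.\<close>
    have "i m + 1 \<in> J"
      using True j unfolding mi(1) seq_labels_def by auto
    then have "i m + 2 \<le> s" "even s \<Longrightarrow> i m + 2 \<noteq> s"
      using add_domino.hyps by (auto dest!: subsetD)
    then show ?thesis
      using True by (cases "i m + 2 = s") (auto simp: i'_def)
  next
    case False
    then show ?thesis
      using mi(3,4)[of j] j by (auto simp: i'_def)
  qed
  then show ?case
    using labels card by blast
qed

section \<open>A two-colouring of domino sets\<close>

text \<open>
  Dominoes with odd first label are the pairs \<open>{x, pair_mate x}\<close>, those with even first label
  are the pairs \<open>{x, link_mate x}\<close>. At \<open>0\<close>, which is never a label, \<open>pair_mate\<close> has a fixed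
  point and \<open>link_mate\<close> gives \<open>1\<close>, so that both are involutions on all natural numbers.
\<close>

definition pair_mate :: "nat \<Rightarrow> nat" where
  "pair_mate x = (if odd x then x + 1 else x - 1)"

definition link_mate :: "nat \<Rightarrow> nat" where
  "link_mate x = (if odd x then x - 1 else x + 1)"

definition unpaired :: "nat set \<Rightarrow> nat set" where
  "unpaired I = {x \<in> I. pair_mate x \<notin> I}"

lemma pair_mate_pair_mate: "pair_mate (pair_mate x) = x"
  by (auto simp: pair_mate_def)

lemma pair_mate_neq: "1 \<le> x \<Longrightarrow> pair_mate x \<noteq> x"
  by (auto simp: pair_mate_def)

lemma link_mate_link_mate: "link_mate (link_mate x) = x"
  by (auto simp: link_mate_def)

lemma link_mate_neq: "link_mate x \<noteq> x"
  by (cases x) (auto simp: link_mate_def)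

text \<open>
  The colouring rests on this property of domino sets: a label without its \<open>pair_mate\<close>
  belongs to an even domino, and by the spacing around even dominoes the other label of that
  domino lacks its \<open>pair_mate\<close>, too.
\<close>

lemma domino_set_unpaired_linked:
  assumes "domino_set I"
  shows "link_mate ` unpaired I \<subseteq> unpaired I"
  using assms
proof (induction rule: domino_set.induct)
  case empty
  show ?case by (simp add: unpaired_def)
next
  case (add_domino J s)
  let ?I = "insert s (insert (s + 1) J)"
  have old: "pair_mate x \<in> J \<or> link_mate x \<in> J \<and> pair_mate (link_mate x) \<notin> J" if "x \<in> J" for x
    using add_domino.IH that by (auto simp: unpaired_def)
  have lt: "1 \<le> x \<and> x < s" if "x \<in> J" for x
    using that add_domino.hyps by auto
  have "link_mate x \<in> ?I \<and> pair_mate (link_mate x) \<notin> ?I" if x: "x \<in> ?I" "pair_mate x \<notin> ?I" for x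
  proof (cases "x \<in> J")
    case True
    have l: "link_mate x \<in> J" "pair_mate (link_mate x) \<notin> J"
      using old[OF True] x by auto
    have "pair_mate (link_mate x) \<noteq> s" "pair_mate (link_mate x) \<noteq> s + 1"
      using lt[OF True] lt[OF l(1)] add_domino.hyps(4) l(1) True
      by (auto simp: pair_mate_def link_mate_def split: if_splits)
    then show ?thesis using l by auto
  next
    case False
    then have "x = s \<or> x = s + 1" using x by auto
    then have "even s"
      using x by (auto simp: pair_mate_def split: if_splits)
    then have "s - 1 \<notin> ?I" "s + 2 \<notin> ?I"
      using add_domino.hyps lt[of "s + 2"] by auto
    then show ?thesis
      using \<open>even s\<close> \<open>x = s \<or> x = s + 1\<close> by (auto simp: pair_mate_def link_mate_def)
  qed
  then show ?case by (auto simp: unpaired_def)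
qed

text \<open>
  \<open>link_mate\<close> exchanges the even and the odd elements.
\<close>

lemma even_card_link_closed:
  assumes "finite H" and closed: "link_mate ` H \<subseteq> H"
  shows "even (card H)"
proof -
  let ?E = "{x \<in> H. even x}"
  have odd_part: "H - ?E = link_mate ` ?E"
  proof
    show "H - ?E \<subseteq> link_mate ` ?E"
    proof
      fix x assume x: "x \<in> H - ?E"
      then have "link_mate x \<in> ?E"
        using closed by (auto simp: link_mate_def split: if_splits)
      then show "x \<in> link_mate ` ?E"
        by (metis image_eqI link_mate_link_mate)
    qed
  qed (use closed in \<open>auto simp: link_mate_def\<close>)
  have "inj_on link_mate ?E"
    by (metis inj_onI link_mate_link_mate)
  then have "card (H - ?E) = card ?E"
    unfolding odd_part by (rule card_image)
  moreover have "card H = card ?E + card (H - ?E)"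
    using assms by (subst card_Un_disjoint[symmetric]) (auto intro: arg_cong[of _ _ card])
  ultimately show ?thesis by simp
qed

text \<open>
  A label added to, or deleted from, a union of even dominoes is the only one without its
  \<open>link_mate\<close>, or the only missing one whose \<open>link_mate\<close> is present. The next two lemmas express
  this by comparing two such sets.
\<close>

lemma link_closed_insert_inj:
  assumes "link_mate ` A \<subseteq> A" "link_mate ` B \<subseteq> B" "p \<notin> A" "q \<notin> B" "insert p A = insert q B"
  shows "p = q"
proof (rule ccontr)
  assume "p \<noteq> q"
  then have "link_mate p \<in> insert p A"
    using assms by blast
  then have "link_mate p \<in> A"
    using link_mate_neq[of p] by simp
  then have "link_mate (link_mate p) \<in> A"
    using assms(1) by blast
  then show False
    using assms(3) by (simp add: link_mate_link_mate)
qed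

lemma link_closed_remove_inj:
  assumes "link_mate ` A \<subseteq> A" "link_mate ` B \<subseteq> B" "p \<in> A" "q \<in> B" "A - {p} = B - {q}"
  shows "p = q"
proof -
  have "link_mate p \<in> A - {p}"
    using assms(1,3) link_mate_neq[of p] by auto
  then have "link_mate (link_mate p) \<in> B"
    using assms(2,5) by blast
  then have "p \<in> B"
    by (simp add: link_mate_link_mate)
  then show "p = q"
    using assms(5) by blast
qed

lemma unpaired_remove_paired:
  assumes "u \<in> I" "pair_mate u \<in> I" "0 \<notin> I"
  shows "unpaired (I - {u}) = insert (pair_mate u) (unpaired I)" "pair_mate u \<notin> unpaired I"
proof -
  have "pair_mate u \<noteq> u"
    using assms by (metis One_nat_def Suc_leI gr0I pair_mate_neq)
  moreover have "x = pair_mate u" if "pair_mate x = u" for x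
    using that pair_mate_pair_mate by metis
  ultimately show "unpaired (I - {u}) = insert (pair_mate u) (unpaired I)"
    using assms by (auto simp: unpaired_def pair_mate_pair_mate)
  show "pair_mate u \<notin> unpaired I"
    using assms by (simp add: unpaired_def pair_mate_pair_mate)
qed

lemma unpaired_remove_unpaired:
  assumes "u \<in> I" "pair_mate u \<notin> I"
  shows "unpaired (I - {u}) = unpaired I - {u}" "u \<in> unpaired I"
  using assms pair_mate_pair_mate by (auto simp: unpaired_def)

text \<open>
  The number of unpaired labels is twice the number of even dominoes, so divisibility by \<open>4\<close> is
  the parity of the latter. Both deletions leave the same set of unpaired labels. If both
  deletions have created an unpaired label, or both have destroyed one, the two preceding lemmas
  identify the deleted labels. In the mixed cases the two original numbers differ by \<open>2\<close>.
\<close>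

lemma colour_change:
  assumes I: "domino_set I" and J: "domino_set J" and "I \<noteq> J"
    and uv: "u \<in> I" "v \<in> J" "I - {u} = J - {v}"
  shows "4 dvd card (unpaired I) \<longleftrightarrow> \<not> 4 dvd card (unpaired J)"
proof -
  have "u \<noteq> v" using uv \<open>I \<noteq> J\<close> by auto
  have zero: "0 \<notin> I" "0 \<notin> J"
    using domino_set_ge_1[OF I] domino_set_ge_1[OF J] by auto
  have fin: "finite (unpaired I)" "finite (unpaired J)"
    using domino_set_finite[OF I] domino_set_finite[OF J] by (auto simp: unpaired_def)
  note closed = domino_set_unpaired_linked[OF I] domino_set_unpaired_linked[OF J]
  have even: "even (card (unpaired I))" "even (card (unpaired J))"
    using even_card_link_closed fin closed by auto
  have K: "unpaired (I - {u}) = unpaired (J - {v})"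
    by (simp add: uv)
  have "pair_mate u \<noteq> pair_mate v"
    using \<open>u \<noteq> v\<close> by (metis pair_mate_pair_mate)
  have "card (unpaired I) = card (unpaired J) + 2 \<or> card (unpaired J) = card (unpaired I) + 2"
  proof (cases "pair_mate u \<in> I"; cases "pair_mate v \<in> J")
    assume "pair_mate u \<in> I" "pair_mate v \<in> J"
    note * = unpaired_remove_paired[OF uv(1) this(1) zero(1)]
      unpaired_remove_paired[OF uv(2) this(2) zero(2)]
    show ?thesis
      using link_closed_insert_inj[OF closed *(2,4)] K \<open>pair_mate u \<noteq> pair_mate v\<close>
      by (simp add: *(1,3))
  next
    assume "pair_mate u \<notin> I" "pair_mate v \<notin> J"
    note * = unpaired_remove_unpaired[OF uv(1) this(1)] unpaired_remove_unpaired[OF uv(2) this(2)]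
    show ?thesis
      using link_closed_remove_inj[OF closed *(2,4)] K \<open>u \<noteq> v\<close> by (simp add: *(1,3))
  next
    assume "pair_mate u \<in> I" "pair_mate v \<notin> J"
    note * = unpaired_remove_paired[OF uv(1) this(1) zero(1)]
      unpaired_remove_unpaired[OF uv(2) this(2)]
    have "card (insert (pair_mate u) (unpaired I)) = card (unpaired J - {v})"
      using K by (simp add: *(1,3))
    then show ?thesis
      using *(2,4) fin card_gt_0_iff[of "unpaired J"] by (auto simp: card_Diff_singleton)
  next
    assume "pair_mate u \<notin> I" "pair_mate v \<in> J"
    note * = unpaired_remove_unpaired[OF uv(1) this(1)]
      unpaired_remove_paired[OF uv(2) this(2) zero(2)]
    have "card (insert (pair_mate v) (unpaired J)) = card (unpaired I - {u})"
      using K by (simp add: *(1,3))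
    then show ?thesis
      using *(2,4) fin card_gt_0_iff[of "unpaired I"] by (auto simp: card_Diff_singleton)
  qed
  then show ?thesis
    using even by presburger
qed

section \<open>The number of domino sets\<close>

definition domino_sets :: "nat \<Rightarrow> nat \<Rightarrow> nat set set" where
  "domino_sets n m = {I. domino_set I \<and> I \<subseteq> {1..n} \<and> card I = 2 * m}"

lemma finite_domino_sets: "finite (domino_sets n m)"
  by (rule finite_subset[of _ "Pow {1..n}"]) (auto simp: domino_sets_def)

text \<open>
  The largest label ends the last domino, so this domino is \<open>{n, n + 1}\<close>. If \<open>n\<close> is even it must
  not touch the rest, and the label \<open>n - 1\<close> is lost as well.
\<close>

lemma domino_set_with_last:
  assumes "1 \<le> n"
  shows "domino_set I \<and> I \<subseteq> {1..Suc n} \<and> Suc n \<in> I \<longleftrightarrow>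
    (\<exists>J. domino_set J \<and> J \<subseteq> {1..if odd n then n - 1 else n - 2} \<and> I = insert n (insert (n + 1) J))"
    (is "?L \<longleftrightarrow> ?R")
proof
  assume L: ?L
  then have "domino_set I" by blast
  then show ?R
  proof cases
    case empty
    then show ?thesis using L by blast
  next
    case (add_domino J s)
    have "s = n"
      using L add_domino by auto
    moreover have "J \<subseteq> {1..if odd n then n - 1 else n - 2}"
    proof
      fix x assume that: "x \<in> J"
      have "1 \<le> x" "x < n" using that add_domino \<open>s = n\<close> by auto
      moreover have "even n \<Longrightarrow> x \<noteq> n - 1" using that add_domino \<open>s = n\<close> by auto
      ultimately show "x \<in> {1..if odd n then n - 1 else n - 2}" by auto
    qed
    ultimately show ?thesis
      using add_domino by blast
  qed
next
  assume ?R
  then obtain J where J: "domino_set J" "J \<subseteq> {1..if odd n then n - 1 else n - 2}"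
    "I = insert n (insert (n + 1) J)" by blast
  have bound: "1 \<le> x \<and> x < n \<and> (even n \<longrightarrow> x \<noteq> n - 1)" if "x \<in> J" for x
    using subsetD[OF J(2) that] by (auto split: if_splits)
  then have "domino_set I"
    unfolding J(3) using J(1) assms by (intro domino_set.add_domino) auto
  moreover have "I \<subseteq> {1..Suc n}"
    unfolding J(3) using assms bound by fastforce
  ultimately show ?L
    using J(3) by auto
qed

lemma card_domino_sets_Suc:
  assumes "1 \<le> n"
  shows "card (domino_sets (Suc n) (Suc m)) =
    card (domino_sets n (Suc m)) + card (domino_sets (if odd n then n - 1 else n - 2) m)"
proof -
  let ?k = "if odd n then n - 1 else n - 2"
  let ?add = "\<lambda>J. insert n (insert (n + 1) J)"
  have fresh: "n \<notin> J \<and> n + 1 \<notin> J" if "J \<in> domino_sets ?k m" for J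
  proof -
    have "J \<subseteq> {1..?k}" using that by (simp add: domino_sets_def)
    also have "\<dots> \<subseteq> {1..n - 1}" by auto
    finally show ?thesis using assms by auto
  qed
  have card_add: "card (?add J) = card J + 2" if "domino_set J" "J \<subseteq> {1..?k}" for J
  proof -
    note that(2)
    also have "{1..?k} \<subseteq> {1..n - 1}" by auto
    finally have "n \<notin> J" "n + 1 \<notin> J" using assms by auto
    then show ?thesis using domino_set_finite[OF that(1)] by simp
  qed
  have "domino_sets (Suc n) (Suc m) = domino_sets n (Suc m) \<union> ?add ` domino_sets ?k m"
  proof (intro set_eqI)
    fix I
    have "I \<in> domino_sets (Suc n) (Suc m) \<longleftrightarrow> I \<in> domino_sets n (Suc m) \<or>
      (domino_set I \<and> I \<subseteq> {1..Suc n} \<and> Suc n \<in> I) \<and> card I = 2 * Suc m"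
      by (auto simp: domino_sets_def atLeastAtMostSuc_conv)
    also have "\<dots> \<longleftrightarrow> I \<in> domino_sets n (Suc m) \<or> I \<in> ?add ` domino_sets ?k m"
      unfolding domino_set_with_last[OF assms]
      using card_add by (fastforce simp: domino_sets_def image_iff)
    finally show "I \<in> domino_sets (Suc n) (Suc m) \<longleftrightarrow>
      I \<in> domino_sets n (Suc m) \<union> ?add ` domino_sets ?k m" by simp
  qed
  moreover have "domino_sets n (Suc m) \<inter> ?add ` domino_sets ?k m = {}"
    by (auto simp: domino_sets_def)
  moreover have "inj_on ?add (domino_sets ?k m)"
    using fresh by (intro inj_onI) (metis insert_ident insert_iff n_not_Suc_n Suc_eq_plus1)
  ultimately show ?thesis
    by (simp add: card_Un_disjoint finite_domino_sets card_image)
qed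

lemma domino_sets_0: "domino_sets n 0 = {{}}"
  by (auto simp: domino_sets_def domino_set.empty dest: domino_set_finite)

lemma domino_sets_short:
  assumes "n \<le> 1"
  shows "domino_sets n (Suc m) = {}"
proof -
  have "card I \<noteq> 2 * Suc m" if "I \<subseteq> {1..n}" for I
    using card_mono[OF _ that] assms by simp
  then show ?thesis by (auto simp: domino_sets_def)
qed

text \<open>
  The coefficient of \<open>X^n\<close> in the generating function: a polynomial in \<open>Y\<close>, kept as a power
  series.
\<close>

definition domino_poly :: "nat \<Rightarrow> rat fps" where
  "domino_poly n = Abs_fps (\<lambda>m. of_nat (card (domino_sets n m)))"

lemma domino_poly_short:
  assumes "n \<le> 1"
  shows "domino_poly n = 1"
proof (rule fps_ext)
  fix m
  show "domino_poly n $ m = 1 $ m"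
    by (cases m) (auto simp: domino_poly_def domino_sets_0 domino_sets_short[OF assms])
qed

lemma domino_poly_Suc:
  assumes "1 \<le> n"
  shows "domino_poly (Suc n) =
    domino_poly n + fps_X * domino_poly (if odd n then n - 1 else n - 2)"
proof (rule fps_ext)
  fix m
  show "domino_poly (Suc n) $ m =
    (domino_poly n + fps_X * domino_poly (if odd n then n - 1 else n - 2)) $ m"
    using card_domino_sets_Suc[OF assms]
    by (cases m) (simp_all add: domino_poly_def domino_sets_0)
qed

text \<open>
  For even \<open>n\<close> this combines two steps of the recurrence above. For odd \<open>n\<close> these two steps add
  \<open>2 Y\<close> times the term at \<open>n + 1\<close>, and twice that term is the sum of the terms at \<open>n + 2\<close> and
  \<open>n\<close>, because the increments from \<open>n\<close> to \<open>n + 1\<close> and from \<open>n + 1\<close> to \<open>n + 2\<close> coincide.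
\<close>

lemma domino_poly_rec:
  "domino_poly (n + 4) = domino_poly (n + 2) + fps_X * domino_poly (n + 2) + fps_X * domino_poly n"
proof -
  let ?p = domino_poly
  have odd_step: "?p (Suc k) = ?p k + fps_X * ?p (k - 1)" if "odd k" for k
    using that domino_poly_Suc[of k] by (auto simp: odd_pos Suc_leI)
  have even_step: "?p (Suc (Suc (Suc k))) = ?p (Suc (Suc k)) + fps_X * ?p k" if "even k" for k
    using that domino_poly_Suc[of "Suc (Suc k)"] by simp
  have "?p (Suc (Suc (Suc (Suc n)))) = ?p (Suc (Suc n)) + fps_X * ?p (Suc (Suc n)) + fps_X * ?p n"
  proof (cases "even n")
    case True
    then show ?thesis
      using odd_step[of "Suc (Suc (Suc n))"] even_step[of n] by simp
  next
    case False
    then obtain k where k: "n = Suc k" "even k"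
      by (cases n) auto
    have "?p (Suc (Suc (Suc (Suc n)))) = ?p (Suc (Suc n)) + fps_X * ?p (Suc n) + fps_X * ?p (Suc n)"
      using odd_step[of "Suc (Suc n)"] even_step[of "Suc n"] False by simp
    moreover have "?p (Suc n) + ?p (Suc n) = ?p (Suc (Suc n)) + ?p n"
      using odd_step[of n] even_step[of k] k by (simp add: algebra_simps)
    then have "fps_X * ?p (Suc n) + fps_X * ?p (Suc n) = fps_X * ?p (Suc (Suc n)) + fps_X * ?p n"
      by (simp flip: distrib_left)
    ultimately show ?thesis
      by (simp add: add.assoc)
  qed
  then show ?thesis
    by (simp add: eval_nat_numeral)
qed

text \<open>
  By the recurrence, the product of the generating function with the denominator has no terms
  from \<open>X^4\<close> on, and the first four terms give the numerator. The denominator is not a zero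
  divisor.
\<close>

lemma S_series_nth: "S_series $ n = domino_poly n"
proof -
  define D :: "rat fps fps" where
    "D = 1 - ser_X ^ 2 - ser_X ^ 2 * ser_Y - ser_X ^ 4 * ser_Y"
  have "Abs_fps domino_poly * D = 1 + ser_X + ser_X ^ 3 * ser_Y"
  proof (rule fps_ext)
    fix n
    have p2: "domino_poly 2 = 1 + fps_X" and p3: "domino_poly 3 = 1 + 2 * fps_X"
      using domino_poly_Suc[of 1] domino_poly_Suc[of 2]
      by (simp_all add: domino_poly_short eval_nat_numeral algebra_simps)
    have "Abs_fps domino_poly * D = Abs_fps domino_poly
        - Abs_fps domino_poly * ser_X ^ 2 * fps_const (1 + fps_X)
        - Abs_fps domino_poly * ser_X ^ 4 * ser_Y"
      by (simp add: D_def algebra_simps flip: fps_const_add)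
    then have "(Abs_fps domino_poly * D) $ n = domino_poly n
        - (if n < 2 then 0 else (1 + fps_X) * domino_poly (n - 2))
        - (if n < 4 then 0 else fps_X * domino_poly (n - 4))"
      by (simp add: fps_X_power_mult_right_nth mult.commute)
    also have "\<dots> = (1 + ser_X + ser_X ^ 3 * ser_Y) $ n"
    proof -
      have "n = 0 \<or> n = 1 \<or> n = 2 \<or> n = 3 \<or> (\<exists>k. n = k + 4)"
        by presburger
      then consider "n = 0" | "n = 1" | "n = 2" | "n = 3" | k where "n = k + 4"
        by blast
      then show ?thesis
        by cases (simp_all add: domino_poly_short p2 p3 domino_poly_rec
            fps_X_power_mult_nth algebra_simps)
    qed
    finally show "(Abs_fps domino_poly * D) $ n = (1 + ser_X + ser_X ^ 3 * ser_Y) $ n" .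
  qed
  also have "\<dots> = S_series * D"
    unfolding D_def by (rule S_series_times_denominator[symmetric])
  finally have "Abs_fps domino_poly * D = S_series * D" .
  moreover have "D $ 0 = 1"
    by (simp add: D_def)
  then have "D \<noteq> 0" by auto
  ultimately have S: "S_series = Abs_fps domino_poly"
    by simp
  show ?thesis
    unfolding S by (rule fps_nth_Abs_fps)
qed

section \<open>Simplices on the moment curve\<close>

text \<open>
  The values of a polynomial along the moment curve are those of an affine functional whose
  coefficients are the coefficients of the polynomial. The lifted curve has one more
  coordinate and so reaches degree \<open>d + 1\<close>.
\<close>

lemma poly_eq_inner_moment_point:
  fixes e :: "'d::finite \<Rightarrow> nat" and p :: "real poly"
  assumes e: "bij_betw e UNIV {1..CARD('d)}" and deg: "degree p \<le> CARD('d) + 1"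
  shows "poly p t = coeff p 0 + (\<chi> k. coeff p (e k)) \<bullet> moment_point e t
    + coeff p (CARD('d) + 1) * t ^ (CARD('d) + 1)"
proof -
  let ?d = "CARD('d)"
  have "poly p t = (\<Sum>i\<le>?d + 1. coeff p i * t ^ i)"
    unfolding poly_altdef using deg
    by (intro sum.mono_neutral_left) (auto simp: coeff_eq_0)
  also have "{..?d + 1} = insert 0 (insert (?d + 1) {1..?d})"
    by auto
  also have "(\<Sum>i\<in>\<dots>. coeff p i * t ^ i)
      = coeff p 0 + (\<Sum>i\<in>{1..?d}. coeff p i * t ^ i) + coeff p (?d + 1) * t ^ (?d + 1)"
    by simp
  also have "(\<Sum>i\<in>{1..?d}. coeff p i * t ^ i) = (\<Sum>k\<in>UNIV. coeff p (e k) * t ^ e k)"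
    using sum.reindex_bij_betw[OF e, of "\<lambda>i. coeff p i * t ^ i"] by simp
  also have "\<dots> = (\<chi> k. coeff p (e k)) \<bullet> moment_point e t"
    by (simp add: inner_vec_def moment_point_def)
  finally show ?thesis .
qed

definition vanishing_poly :: "(nat \<Rightarrow> real) \<Rightarrow> nat set \<Rightarrow> real poly" where
  "vanishing_poly a I = (\<Prod>i\<in>I. [:- a i, 1:])"

lemma poly_vanishing_poly: "poly (vanishing_poly a I) t = (\<Prod>i\<in>I. t - a i)"
  by (simp add: vanishing_poly_def poly_prod)

lemma degree_vanishing_poly: "degree (vanishing_poly a I) = card I"
  by (simp add: vanishing_poly_def degree_prod_eq_sum_degree)

lemma coeff_vanishing_poly_card: "coeff (vanishing_poly a I) (card I) = 1"
  using lead_coeff_prod[of "\<lambda>i. [:- a i, 1:]" I]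
  by (simp add: degree_vanishing_poly[symmetric, of I a]) (simp add: vanishing_poly_def)

text \<open>
  The two factors of a domino have the same sign at every point, since its labels are consecutive.
\<close>

lemma poly_vanishing_poly_domino_set:
  assumes a: "strict_mono_on {1..n} a" and "domino_set I" "I \<subseteq> {1..n}" "k \<in> {1..n}"
  shows "poly (vanishing_poly a I) (a k) \<ge> 0"
  using assms(2-4)
proof (induction rule: domino_set.induct)
  case empty
  show ?case by (simp add: poly_vanishing_poly)
next
  case (add_domino J s)
  have mono: "a i \<le> a j" if "i \<in> {1..n}" "j \<in> {1..n}" "i \<le> j" for i j
    using a that by (meson strict_mono_on_leD)
  have "k \<le> s \<or> s + 1 \<le> k" by linarith
  then have "(a k - a s) * (a k - a (s + 1)) \<ge> 0"
  proof
    assume "k \<le> s"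
    then show ?thesis
      using mono[of k s] mono[of k "s + 1"] add_domino.prems
      by (intro mult_nonpos_nonpos) auto
  next
    assume "s + 1 \<le> k"
    then show ?thesis
      using mono[of s k] mono[of "s + 1" k] add_domino.prems
      by (intro mult_nonneg_nonneg) auto
  qed
  moreover have "poly (vanishing_poly a J) (a k) \<ge> 0"
    using add_domino by simp
  moreover have "s \<notin> J" "s + 1 \<notin> J" "finite J"
    using add_domino.hyps domino_set_finite by auto
  ultimately show ?case
    by (simp add: poly_vanishing_poly flip: mult.assoc)
qed

lemma poly_vanishing_poly_eq_0_iff:
  assumes a: "strict_mono_on {1..n} a" and "I \<subseteq> {1..n}" "k \<in> {1..n}"
  shows "poly (vanishing_poly a I) (a k) = 0 \<longleftrightarrow> k \<in> I"
proof -
  have "finite I" using assms(2) finite_subset by blast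
  moreover have "a k = a i \<longleftrightarrow> k = i" if "i \<in> I" for i
    using strict_mono_on_eqD[OF a] assms that by blast
  ultimately show ?thesis
    by (auto simp: poly_vanishing_poly prod_zero_iff)
qed

lemma inj_on_moment_point:
  fixes a :: "nat \<Rightarrow> real" and e :: "'d::finite \<Rightarrow> nat"
  assumes a: "strict_mono_on {1..n} a" and e: "bij_betw e UNIV {1..CARD('d)}"
  shows "inj_on (\<lambda>i. moment_point e (a i)) {1..n}"
proof -
  have "1 \<in> range e"
    using e by (simp add: bij_betw_def Suc_leI)
  then obtain k where k: "e k = 1" by auto
  have "a i = a j" if "moment_point e (a i) = moment_point e (a j)" for i j
    using arg_cong[OF that, of "\<lambda>x. x $ k"] by (simp add: moment_point_def k)
  then show ?thesis
    using strict_mono_on_imp_inj_on[OF a] by (meson inj_on_def)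
qed

text \<open>
  For each of the points, the polynomial that vanishes at all the others has degree at most \<open>d\<close>
  and separates the point from their affine hull.
\<close>

lemma moment_points_affine_independent:
  fixes a :: "nat \<Rightarrow> real" and e :: "'d::finite \<Rightarrow> nat"
  assumes a: "strict_mono_on {1..n} a" and e: "bij_betw e UNIV {1..CARD('d)}"
    and I: "I \<subseteq> {1..n}" "card I \<le> CARD('d) + 1"
  shows "\<not> affine_dependent ((\<lambda>i. moment_point e (a i)) ` I)"
proof
  let ?P = "\<lambda>i. moment_point e (a i)"
  have fin: "finite I" using I finite_subset by blast
  assume "affine_dependent (?P ` I)"
  then obtain i where i: "i \<in> I" "?P i \<in> affine hull (?P ` I - {?P i})"
    by (auto simp: affine_dependent_def)
  define q where "q = vanishing_poly a (I - {i})"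
  have deg: "degree q \<le> CARD('d)"
    using I(2) i(1) fin by (simp add: q_def degree_vanishing_poly card_Diff_singleton)
  have value_eq: "poly q t = coeff q 0 + (\<chi> k. coeff q (e k)) \<bullet> moment_point e t" for t
    using poly_eq_inner_moment_point[OF e, of q t] deg by (simp add: coeff_eq_0)
  let ?Z = "{x. (\<chi> k. coeff q (e k)) \<bullet> x = - coeff q 0}"
  have zero: "poly q (a j) = 0 \<longleftrightarrow> j \<in> I - {i}" if "j \<in> I" for j
    unfolding q_def using I that by (intro poly_vanishing_poly_eq_0_iff[OF a]) auto
  have "?P ` I - {?P i} \<subseteq> ?Z"
  proof
    fix x assume "x \<in> ?P ` I - {?P i}"
    then obtain j where j: "x = ?P j" "j \<in> I" "j \<noteq> i" by auto
    then show "x \<in> ?Z" using zero[of j] value_eq[of "a j"] by simp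
  qed
  then have "affine hull (?P ` I - {?P i}) \<subseteq> ?Z"
    by (intro hull_minimal affine_hyperplane)
  then have "poly q (a i) = 0"
    using i(2) value_eq[of "a i"] by auto
  then show False
    using zero[of i] i(1) by simp
qed

lemma simplex_hull_of_labels:
  fixes a :: "nat \<Rightarrow> real" and e :: "'d::finite \<Rightarrow> nat"
  assumes a: "strict_mono_on {1..n} a" and e: "bij_betw e UNIV {1..CARD('d)}"
    and I: "I \<subseteq> {1..n}" "card I = CARD('d) + 1"
  shows "int CARD('d) simplex hull_of_labels e a I"
proof -
  have "card ((\<lambda>i. moment_point e (a i)) ` I) = CARD('d) + 1"
    using card_image[OF inj_on_subset[OF inj_on_moment_point[OF a e] I(1)]] I(2) by simp
  then show ?thesis
    using moment_points_affine_independent[OF a e I(1)] I(2)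
    unfolding simplex_def hull_of_labels_def by (metis le_refl of_nat_1 of_nat_add)
qed

text \<open>
  The labels of a simplex are determined by its extreme points.
\<close>

lemma hull_of_labels_inj:
  fixes a :: "nat \<Rightarrow> real" and e :: "'d::finite \<Rightarrow> nat"
  assumes a: "strict_mono_on {1..n} a" and e: "bij_betw e UNIV {1..CARD('d)}"
    and I: "I \<subseteq> {1..n}" "card I \<le> CARD('d) + 1" and J: "J \<subseteq> {1..n}" "card J \<le> CARD('d) + 1"
    and eq: "hull_of_labels e a I = hull_of_labels e a J"
  shows "I = J"
proof -
  let ?P = "\<lambda>i. moment_point e (a i)"
  have extreme: "?P ` L = {x. x extreme_point_of hull_of_labels e a L}"
    if L: "L \<subseteq> {1..n}" "card L \<le> CARD('d) + 1" for L
    unfolding hull_of_labels_def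
      extreme_point_of_convex_hull_affine_independent[OF moment_points_affine_independent[OF a e L]]
    by (rule Collect_mem_eq[symmetric])
  have "?P ` I = ?P ` J"
    unfolding extreme[OF I] extreme[OF J] eq ..
  then show ?thesis
    using inj_on_image_eq_iff[OF inj_on_moment_point[OF a e] I(1) J(1)] by simp
qed

lemma facet_of_hull_of_labels:
  fixes a :: "nat \<Rightarrow> real" and e :: "'d::finite \<Rightarrow> nat"
  assumes a: "strict_mono_on {1..n} a" and e: "bij_betw e UNIV {1..CARD('d)}"
    and I: "I \<subseteq> {1..n}" "card I \<le> CARD('d) + 1"
    and F: "F facet_of hull_of_labels e a I"
  obtains u where "u \<in> I" "F = hull_of_labels e a (I - {u})"
proof -
  let ?P = "\<lambda>i. moment_point e (a i)"
  obtain u where u: "u \<in> I" "F = convex hull (?P ` I - {?P u})"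
    using F facet_of_convex_hull_affine_independent[OF moment_points_affine_independent[OF a e I]]
    unfolding hull_of_labels_def by blast
  have "?P ` (I - {u}) = ?P ` I - ?P ` {u}"
    by (rule inj_on_image_set_diff[OF inj_on_moment_point[OF a e]]) (use I(1) u(1) in auto)
  then show ?thesis
    using that[OF u(1)] u(2) by (simp add: hull_of_labels_def)
qed

text \<open>
  The vanishing polynomial of the labels supports the lifted polytope from below: it is
  nonnegative on all vertices, zero exactly on the given ones, and its leading coefficient \<open>1\<close> is
  the coefficient of the last coordinate, so that the face where it vanishes is lower.
\<close>

lemma hull_of_domino_set_in_lower_triangulation:
  fixes a :: "nat \<Rightarrow> real" and e :: "'d::finite \<Rightarrow> nat"
  assumes a: "strict_mono_on {1..n} a" and e: "bij_betw e UNIV {1..CARD('d)}"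
    and I: "domino_set I" "I \<subseteq> {1..n}" "card I = CARD('d) + 1"
  shows "hull_of_labels e a I \<in> lower_triangulation e a n"
proof -
  let ?L = "\<lambda>i. (moment_point e (a i), a i ^ (CARD('d) + 1))"
  define p where "p = vanishing_poly a I"
  define c :: "(real ^ 'd) \<times> real" where "c = (\<chi> k. coeff p (e k), 1)"
  have value_eq: "c \<bullet> ?L k = poly p (a k) - coeff p 0" for k
    using poly_eq_inner_moment_point[OF e, of p "a k"] I(3)
      coeff_vanishing_poly_card[of a I]
    by (simp add: c_def p_def degree_vanishing_poly)
  have on: "c \<bullet> ?L k = - coeff p 0" if "k \<in> I" for k
    using poly_vanishing_poly_eq_0_iff[OF a I(2), of k] that I(2) value_eq[of k]
    by (auto simp: p_def)
  have above: "c \<bullet> ?L k > - coeff p 0" if "k \<in> {1..n} - I" for k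
    using poly_vanishing_poly_eq_0_iff[OF a I(2), of k] that value_eq[of k]
      poly_vanishing_poly_domino_set[OF a I(1,2), of k]
    by (auto simp: p_def less_le)
  let ?F = "convex hull (?L ` I)"
  have affI: "affine hull (?L ` I) \<subseteq> {x. c \<bullet> x = - coeff p 0}"
    using on by (intro hull_minimal affine_hyperplane) blast
  then have F0: "?F \<subseteq> {x. c \<bullet> x = - coeff p 0}"
    using convex_hull_subset_affine_hull by blast
  have "convex hull (?L ` {1..n} - ?L ` I) \<subseteq> {x. c \<bullet> x > - coeff p 0}"
    using above by (intro hull_minimal convex_halfspace_gt) blast
  then have "affine hull (?L ` I) \<inter> convex hull (?L ` {1..n} - ?L ` I) = {}"
    using affI by force
  then have face: "?F face_of lifted_cyclic_polytope e a n"
    unfolding lifted_cyclic_polytope_def using I(2) by (intro face_of_convex_hulls) auto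
  have C0: "lifted_cyclic_polytope e a n \<subseteq> {x. c \<bullet> x \<ge> - coeff p 0}"
    unfolding lifted_cyclic_polytope_def
    using on above by (intro hull_minimal convex_halfspace_ge) force
  have "s \<le> t" if "(x, s) \<in> ?F" "(x, t) \<in> lifted_cyclic_polytope e a n" for x s t
  proof -
    have "c \<bullet> (x, s) \<le> c \<bullet> (x, t)"
      using subsetD[OF F0 that(1)] subsetD[OF C0 that(2)] by simp
    then show ?thesis by (simp add: c_def)
  qed
  then have "lower_face_of ?F (lifted_cyclic_polytope e a n)"
    using face by (auto simp: lower_face_of_def)
  moreover have "fst ` ?F = hull_of_labels e a I"
    unfolding hull_of_labels_def
    by (simp add: convex_hull_linear_image[OF linear_fst] image_image)
  ultimately show ?thesis
    unfolding lower_triangulation_def by blast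
qed

lemma S_maximal_simplices_eq:
  fixes a :: "nat \<Rightarrow> real" and e :: "'d::finite \<Rightarrow> nat"
  assumes a: "strict_mono_on {1..n} a" and e: "bij_betw e UNIV {1..CARD('d)}"
    and d: "odd CARD('d)"
  shows "S_maximal_simplices e a n = hull_of_labels e a ` domino_sets n ((CARD('d) + 1) div 2)"
proof -
  let ?d = "CARD('d)"
  let ?m = "(?d + 1) div 2"
  have m: "2 * ?m = ?d + 1" "1 \<le> ?m"
    using d by (auto elim!: oddE)
  define Q where "Q i \<longleftrightarrow> simplex_seq n ?m i \<and>
    (\<forall>j. 1 \<le> j \<and> j < ?m \<longrightarrow> odd (i j) \<or> int (i (j + 1)) - int (i j) > 2)" for i
  have seq_of_domino_set: "\<exists>i. I = seq_labels ?m i \<and> Q i" if I: "I \<in> domino_sets n ?m" for I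
  proof -
    obtain m' i where i: "I = seq_labels m' i" "card I = 2 * m'"
      "\<forall>j. 1 \<le> j \<and> j < m' \<longrightarrow> i j + 2 \<le> i (j + 1) \<and> (odd (i j) \<or> i j + 2 < i (j + 1))"
      using domino_set_imp_seq_labels[of I] I by (auto simp: domino_sets_def)
    have "m' = ?m" using I i(2) by (simp add: domino_sets_def)
    have "i 1 \<in> I" "i ?m + 1 \<in> I"
      using m(2) unfolding i(1) \<open>m' = ?m\<close> seq_labels_def by fastforce+
    then have "1 \<le> i 1" "i ?m + 1 \<le> n"
      using I by (auto simp: domino_sets_def)
    then have "Q i"
      using i(3) \<open>m' = ?m\<close> by (fastforce simp: Q_def simplex_seq_def)
    then show ?thesis
      using i(1) \<open>m' = ?m\<close> by blast
  qed
  have domino_set_of_seq: "seq_labels ?m i \<in> domino_sets n ?m" if i: "Q i" for i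
  proof -
    have "domino_set (seq_labels ?m i) \<and> seq_labels ?m i \<subseteq> {1..i ?m + 1}
        \<and> card (seq_labels ?m i) = 2 * ?m"
    proof (rule domino_set_seq_labels)
      fix j assume "1 \<le> j" "j < ?m"
      then have "odd (i j) \<or> int (i (j + 1)) - int (i j) > 2"
        using i unfolding Q_def by blast
      then show "odd (i j) \<or> i j + 2 < i (j + 1)" by linarith
    qed (use m i in \<open>auto simp: Q_def simplex_seq_def\<close>)
    then show ?thesis
      using i by (force simp: domino_sets_def Q_def simplex_seq_def)
  qed
  have simplex: "hull_of_labels e a I \<in> simplices_of_dim ?d (lower_triangulation e a n)"
    if "I \<in> domino_sets n ?m" for I
    using that simplex_hull_of_labels[OF a e, of I] m
      hull_of_domino_set_in_lower_triangulation[OF a e, of I]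
    by (auto simp: simplices_of_dim_def domino_sets_def)
  have S: "S_maximal_simplices e a n = {\<sigma> \<in> simplices_of_dim ?d (lower_triangulation e a n).
      \<exists>i. \<sigma> = hull_of_labels e a (seq_labels ?m i) \<and> Q i}"
    unfolding S_maximal_simplices_def Q_def by (intro Collect_cong) (simp only: conj_ac)
  show ?thesis
  proof (intro equalityI subsetI)
    fix \<sigma> assume "\<sigma> \<in> S_maximal_simplices e a n"
    then show "\<sigma> \<in> hull_of_labels e a ` domino_sets n ?m"
      unfolding S using domino_set_of_seq by auto
  next
    fix \<sigma> assume "\<sigma> \<in> hull_of_labels e a ` domino_sets n ?m"
    then obtain I where I: "I \<in> domino_sets n ?m" "\<sigma> = hull_of_labels e a I" by blast
    then show "\<sigma> \<in> S_maximal_simplices e a n"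
      unfolding S using simplex[OF I(1)] seq_of_domino_set[OF I(1)] by auto
  qed
qed

text \<open>
  A face of the same dimension is the whole simplex, so closing under faces adds no \<open>d\<close>-simplex.
\<close>

lemma simplices_of_dim_S_complex:
  fixes e :: "'d::finite \<Rightarrow> nat"
  shows "simplices_of_dim CARD('d) (S_complex e a n) = S_maximal_simplices e a n"
proof (intro equalityI subsetI)
  fix \<tau> assume "\<tau> \<in> simplices_of_dim CARD('d) (S_complex e a n)"
  then obtain \<sigma> where s: "\<sigma> \<in> S_maximal_simplices e a n" "\<tau> face_of \<sigma>" "int CARD('d) simplex \<tau>"
    by (auto simp: simplices_of_dim_def S_complex_def)
  have "int CARD('d) simplex \<sigma>"
    using s(1) by (simp add: S_maximal_simplices_def simplices_of_dim_def)
  then have "aff_dim \<tau> = aff_dim \<sigma>" "convex \<sigma>"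
    using s(3) by (auto simp: aff_dim_simplex convex_simplex)
  then have "\<tau> = \<sigma>"
    using face_of_aff_dim_lt[OF _ s(2)] by force
  then show "\<tau> \<in> S_maximal_simplices e a n" using s(1) by simp
next
  fix \<sigma> assume s: "\<sigma> \<in> S_maximal_simplices e a n"
  then have t: "\<sigma> \<in> lower_triangulation e a n" "int CARD('d) simplex \<sigma>"
    by (auto simp: S_maximal_simplices_def simplices_of_dim_def)
  then have "\<sigma> face_of \<sigma>"
    by (simp add: convex_simplex face_of_refl)
  then show "\<sigma> \<in> simplices_of_dim CARD('d) (S_complex e a n)"
    using s t by (auto simp: simplices_of_dim_def S_complex_def)
qed

section \<open>The dual graph and the number of simplices\<close>

theorem proposition5p5:
  fixes a :: "nat \<Rightarrow> real" and e :: "'d::finite \<Rightarrow> nat" and n :: nat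
  assumes "odd CARD('d)"
    and "n \<ge> CARD('d) + 1"
    and "strict_mono_on {1..n} a"
    and "bij_betw e UNIV {1..CARD('d)}"
  shows "bipartite (simplices_of_dim CARD('d) (S_complex e a n))
                   (dual_graph_edges CARD('d) (S_complex e a n)) \<and>
         of_nat (card (simplices_of_dim CARD('d) (S_complex e a n)))
           = S_series $ n $ ((CARD('d) + 1) div 2)"
proof -
  let ?V = "simplices_of_dim CARD('d) (S_complex e a n)"
  let ?E = "dual_graph_edges CARD('d) (S_complex e a n)"
  let ?m = "(CARD('d) + 1) div 2"
  let ?D = "domino_sets n ?m"
  note a = assms(3) and e = assms(4)
  have V: "?V = hull_of_labels e a ` ?D"
    using simplices_of_dim_S_complex S_maximal_simplices_eq[OF a e assms(1)] by metis
  have D: "domino_set I" "I \<subseteq> {1..n}" "card I = CARD('d) + 1" if "I \<in> ?D" for I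
    using that assms(1) by (auto simp: domino_sets_def)
  have inj: "inj_on (hull_of_labels e a) ?D"
  proof (rule inj_onI)
    fix I J assume "I \<in> ?D" "J \<in> ?D" "hull_of_labels e a I = hull_of_labels e a J"
    then show "I = J"
      using hull_of_labels_inj[OF a e, of I J] D[of I] D[of J] by auto
  qed
  let ?white = "\<lambda>I. 4 dvd card (unpaired I)"
  define A where "A = hull_of_labels e a ` {I \<in> ?D. ?white I}"
  define B where "B = hull_of_labels e a ` {I \<in> ?D. \<not> ?white I}"
  have "\<exists>x\<in>A. \<exists>y\<in>B. E = {x, y}" if E: "E \<in> ?E" for E
  proof -
    have "\<exists>\<sigma> \<tau>. E = {\<sigma>, \<tau>} \<and> \<sigma> \<in> ?V \<and> \<tau> \<in> ?V \<and> \<sigma> \<noteq> \<tau> \<and> (\<exists>F. F facet_of \<sigma> \<and> F facet_of \<tau>)"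
      using E unfolding dual_graph_edges_def by (rule CollectD)
    then obtain \<sigma> \<tau> F where st: "E = {\<sigma>, \<tau>}" "\<sigma> \<in> ?V" "\<tau> \<in> ?V" "\<sigma> \<noteq> \<tau>"
      and facets: "F facet_of \<sigma>" "F facet_of \<tau>"
      by (elim exE conjE)
    obtain I where I: "\<sigma> = hull_of_labels e a I" "I \<in> ?D"
      using st(2) unfolding V by (rule imageE)
    obtain J where J: "\<tau> = hull_of_labels e a J" "J \<in> ?D"
      using st(3) unfolding V by (rule imageE)
    have card_le: "card I \<le> CARD('d) + 1" "card J \<le> CARD('d) + 1"
      using D(3)[OF I(2)] D(3)[OF J(2)] by simp_all
    obtain u where u: "u \<in> I" "F = hull_of_labels e a (I - {u})"
      by (rule facet_of_hull_of_labels[OF a e D(2)[OF I(2)] card_le(1) facets(1)[unfolded I(1)]])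
    obtain v where v: "v \<in> J" "F = hull_of_labels e a (J - {v})"
      by (rule facet_of_hull_of_labels[OF a e D(2)[OF J(2)] card_le(2) facets(2)[unfolded J(1)]])
    have eq: "I - {u} = J - {v}"
    proof (rule hull_of_labels_inj[OF a e])
      show "I - {u} \<subseteq> {1..n}" "J - {v} \<subseteq> {1..n}"
        using D(2)[OF I(2)] D(2)[OF J(2)] by blast+
      show "card (I - {u}) \<le> CARD('d) + 1" "card (J - {v}) \<le> CARD('d) + 1"
        using le_trans[OF card_Diff1_le card_le(1)] le_trans[OF card_Diff1_le card_le(2)] by simp_all
      show "hull_of_labels e a (I - {u}) = hull_of_labels e a (J - {v})"
        using u(2) v(2) by simp
    qed
    have "I \<noteq> J"
      using st(4) I(1) J(1) by blast
    then have "?white I \<longleftrightarrow> \<not> ?white J"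
      using colour_change[OF D(1)[OF I(2)] D(1)[OF J(2)] _ u(1) v(1) eq] by blast
    then show ?thesis
    proof (cases "?white I")
      case True
      then have "\<sigma> \<in> A" "\<tau> \<in> B"
        using I J \<open>?white I \<longleftrightarrow> \<not> ?white J\<close> unfolding A_def B_def by blast+
      then show ?thesis using st(1) by blast
    next
      case False
      then have "\<tau> \<in> A" "\<sigma> \<in> B"
        using I J \<open>?white I \<longleftrightarrow> \<not> ?white J\<close> unfolding A_def B_def by blast+
      then show ?thesis using st(1) by blast
    qed
  qed
  moreover have "A \<union> B = ?V"
    unfolding A_def B_def V by blast
  moreover have "A \<inter> B = {}"
    unfolding A_def B_def using inj_on_image_Int[OF inj, of "{I \<in> ?D. ?white I}" "{I \<in> ?D. \<not> ?white I}"]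
    by auto
  ultimately have "bipartite ?V ?E"
    unfolding bipartite_def by blast
  moreover have "of_nat (card ?V) = S_series $ n $ ?m"
    unfolding V card_image[OF inj] S_series_nth by (simp add: domino_poly_def)
  ultimately show ?thesis by blast
qed

end
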